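(* Let $\epsilon\in(0,1/2)$ and $D>0$. For any $\zeta>0$ and $\sigma>0$ there exist a $\zeta$-Lipschitz generalized linear loss $\ell(w;x)$ (that is, $\ell(w;x)=\phi(w\cdot x)$ with $\phi:\mathbb R\to\mathbb R$ convex and $\zeta$-Lipschitz, $w,x\in\mathbb R$) and two distributions $\mathbb P_A,\mathbb P_B$ on $\mathbb R$, both with variance at most $\sigma^2$, namely $$\mathbb P_A(\{0\})=1-\epsilon,\ \ \mathbb P_A(\{\sigma/\sqrt\epsilon\})=\epsilon,\qquad \mathbb P_B(\{0\})=1-\epsilon,\ \ \mathbb P_B(\{-\sigma/\sqrt\epsilon\})=\epsilon,$$ such that any algorithm which is given $\epsilon$-corrupted samples from an unknown $\mathbb P\in\{\mathbb P_A,\mathbb P_B\}$ and returns $\hat w\in[-D/2,D/2]$ for the problem $\min_{w\in[-D/2,D/2]}\mathbb E_{x\sim\mathbb P}[\ell(w;x)]$ must incur (in the worst case over the adversary) an optimality gap $$\max_{\mathbb P\in\{\mathbb P_A,\mathbb P_B\}}\Big\{\mathbb E_{x\sim\mathbb P}[\ell(\hat w;x)]-\min_{w\in[-D/2,D/2]}\mathbb E_{x\sim\mathbb P}[\ell(w;x)]\Big\}=\Omega\big(\zeta D\sigma\sqrt\epsilon\big),$$ where the constant in $\Omega(\cdot)$ is absolute.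
   Context: **Contamination.** $\epsilon$-corrupted samples from $\mathbb P$: $N$ clean samples are drawn i.i.d. from $\mathbb P$, then an adversary inspects them and replaces an $\epsilon$-fraction by arbitrary points. This model is taken to subsume total-variation contamination, in which the observed samples are drawn i.i.d. from any distribution $\widetilde{\mathbb P}$ with $\mathrm{TV}(\mathbb P,\widetilde{\mathbb P})\le\epsilon$, where $\mathrm{TV}(\mathbb P,\mathbb Q)=\sup_A|\mathbb P(A)-\mathbb Q(A)|$. The algorithm observes only the corrupted samples, and may have any sample size. *)

theory Defs
  imports "HOL-Probability.Probability"
begin

definition sample_space :: "nat \<Rightarrow> (nat \<Rightarrow> real) measure" where
  "sample_space N = PiM {..<N} (\<lambda>_. borel)"

definition iid :: "nat \<Rightarrow> real measure \<Rightarrow> (nat \<Rightarrow> real) measure" where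
  "iid N P = PiM {..<N} (\<lambda>_. P)"

definition tv :: "real measure \<Rightarrow> real measure \<Rightarrow> real" where
  "tv P Q = (SUP A \<in> sets borel. \<bar>measure P A - measure Q A\<bar>)"

text \<open>The two contamination predicates below say that \<open>Q\<close> is a possible law of the \<open>N\<close> observed
  points when the clean distribution is \<open>P\<close>.  In the first, the adversary is a (possibly randomised)
  Markov kernel \<open>T\<close> that sees the whole clean sample and may alter at most \<open>\<epsilon> * N\<close> of its points.\<close>

definition replacement_corruption ::
    "real \<Rightarrow> nat \<Rightarrow> real measure \<Rightarrow> (nat \<Rightarrow> real) measure \<Rightarrow> bool" where
  "replacement_corruption \<epsilon> N P Q \<longleftrightarrow>
     (\<exists>T \<in> sample_space N \<rightarrow>\<^sub>M prob_algebra (sample_space N).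
        (\<forall>x \<in> space (sample_space N).
           AE y in T x. real (card {i \<in> {..<N}. y i \<noteq> x i}) \<le> \<epsilon> * real N) \<and>
        Q = iid N P \<bind> T)"

definition tv_corruption ::
    "real \<Rightarrow> nat \<Rightarrow> real measure \<Rightarrow> (nat \<Rightarrow> real) measure \<Rightarrow> bool" where
  "tv_corruption \<epsilon> N P Q \<longleftrightarrow>
     (\<exists>P'. real_distribution P' \<and> tv P P' \<le> \<epsilon> \<and> Q = iid N P')"

text \<open>A (possibly randomised) algorithm maps the observed sample to the law of its output.\<close>

definition algorithm :: "nat \<Rightarrow> real set \<Rightarrow> ((nat \<Rightarrow> real) \<Rightarrow> real measure) \<Rightarrow> bool" where
  "algorithm N W alg \<longleftrightarrow>
     alg \<in> sample_space N \<rightarrow>\<^sub>M prob_algebra borel \<and>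
     (\<forall>x \<in> space (sample_space N). AE w in alg x. w \<in> W)"

definition population_loss :: "(real \<Rightarrow> real) \<Rightarrow> real measure \<Rightarrow> real \<Rightarrow> real" where
  "population_loss \<phi> P w = (LINT x|P. \<phi> (w * x))"

text \<open>For compact nonempty \<open>W\<close>, Lipschitz \<open>\<phi>\<close> and \<open>P\<close> with finite first moment the infimum is
  attained, so it is the minimum.\<close>

definition optimality_gap :: "(real \<Rightarrow> real) \<Rightarrow> real set \<Rightarrow> real measure \<Rightarrow> real \<Rightarrow> real" where
  "optimality_gap \<phi> W P w = population_loss \<phi> P w - (INF v \<in> W. population_loss \<phi> P v)"

text \<open>Expectation over the observed sample, of law \<open>Q\<close>, and over the internal randomness of the
  algorithm; the loss is still measured under the clean distribution \<open>P\<close>.\<close>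

definition expected_gap :: "(real \<Rightarrow> real) \<Rightarrow> real set \<Rightarrow> real measure \<Rightarrow> (nat \<Rightarrow> real) measure \<Rightarrow>
    ((nat \<Rightarrow> real) \<Rightarrow> real measure) \<Rightarrow> real" where
  "expected_gap \<phi> W P Q alg = (LINT x|Q. LINT w|alg x. optimality_gap \<phi> W P w)"

end

theory Submission
  imports Defs
begin

text \<open>
  Take the linear loss \<open>\<phi> t = \<zeta> * t\<close>.  The clean distributions \<open>P\<^sub>A\<close> and \<open>P\<^sub>B\<close> are mirror images of each
  other, and for every \<open>w\<close> the two optimality gaps add up to \<open>\<zeta> D \<sigma> sqrt \<epsilon>\<close>.  Hence an algorithm that
  sees the same sample in both cases has gap at least half of this in one of them (Le Cam's two-point
  argument).  Under total-variation contamination both samples can be made identically zero.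

  Under replacement the number \<open>K\<close> of nonzero points of a clean sample may exceed \<open>m = \<lfloor>\<epsilon> N\<rfloor>\<close>, so the
  adversary cannot always erase them.  Instead it flips signs: starting from \<open>x \<sim> P\<^sub>A\<close> it flips the first
  \<open>m\<close> nonzero points, and starting from \<open>- x \<sim> P\<^sub>B\<close> it flips the next \<open>m\<close> of them.  The results agree as
  soon as \<open>K \<le> 2 m\<close>, which has probability at least \<open>1/8\<close>: by Markov's inequality if \<open>m \<ge> 1\<close>, and
  because \<open>(1 - \<epsilon>) ^ N \<ge> exp (-2)\<close> if \<open>\<epsilon> N < 1\<close>.
\<close>

subsection \<open>Linear losses and the two-point bound\<close>

text \<open>The population loss is linear in \<open>w\<close> with slope \<open>k\<close> equal to
  \<zeta> times the mean of \<open>P\<close>, so its minimum over the symmetric interval lies at an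
  endpoint and equals \<open>- \<bar>k\<bar> * R\<close>.\<close>

lemma optimality_gap_linear:
  assumes "R \<ge> 0"
  shows "optimality_gap (\<lambda>t. \<zeta> * t) {-R..R} P w =
    \<zeta> * (LINT x|P. x) * w + \<bar>\<zeta> * (LINT x|P. x)\<bar> * R"
proof -
  define k where "k = \<zeta> * (LINT x|P. x)"
  have loss: "population_loss (\<lambda>t. \<zeta> * t) P v = k * v" for v
    unfolding population_loss_def k_def
    by (simp flip: mult.assoc)
  have "(INF v \<in> {-R..R}. k * v) = - (\<bar>k\<bar> * R)"
  proof (rule cInf_eq_minimum)
    show "- (\<bar>k\<bar> * R) \<in> (\<lambda>v. k * v) ` {-R..R}"
      by (rule image_eqI[of _ _ "if k \<ge> 0 then -R else R"]) (use assms in auto)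
    show "- (\<bar>k\<bar> * R) \<le> y" if y: "y \<in> (\<lambda>v. k * v) ` {-R..R}" for y
    proof -
      obtain v where v: "y = k * v" "\<bar>v\<bar> \<le> R"
        using y by fastforce
      then have "\<bar>y\<bar> \<le> \<bar>k\<bar> * R"
        by (simp add: abs_mult mult_left_mono)
      then show ?thesis by linarith
    qed
  qed
  then show ?thesis
    by (simp add: optimality_gap_def loss k_def[symmetric])
qed

lemma algorithm_prob_space:
  assumes "algorithm N W alg" "x \<in> space (sample_space N)"
  shows "prob_space (alg x)" "sets (alg x) = sets borel"
  using assms measurable_space[of alg "sample_space N" "prob_algebra borel" x]
  by (auto simp: algorithm_def space_prob_algebra)

text \<open>As the gap is affine in \<open>w\<close>, a randomised algorithm matters only through
  its mean output. This makes that mean a legitimate integrand over the observed sample.\<close>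

lemma algorithm_mean_measurable:
  assumes "algorithm N W alg"
  shows "(\<lambda>x. LINT w|alg x. w) \<in> borel_measurable (sample_space N)"
proof -
  have "alg \<in> sample_space N \<rightarrow>\<^sub>M subprob_algebra borel"
    using assms by (auto simp: algorithm_def intro: measurable_prob_algebraD)
  then show ?thesis
    by (rule measurable_compose) measurable
qed

lemma algorithm_integrable:
  assumes "algorithm N {-R..R} alg" "x \<in> space (sample_space N)"
  shows "integrable (alg x) (\<lambda>w. w)"
proof -
  interpret prob_space "alg x"
    using algorithm_prob_space[OF assms] by simp
  have [measurable_cong]: "sets (alg x) = sets borel"
    using algorithm_prob_space[OF assms] by simp
  have "AE w in alg x. w \<in> {-R..R}"
    using assms by (simp add: algorithm_def)
  then show ?thesis
    by (intro integrable_const_bound[where B = R]) auto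
qed

lemma algorithm_mean_bound:
  assumes "algorithm N {-R..R} alg" "x \<in> space (sample_space N)"
  shows "\<bar>LINT w|alg x. w\<bar> \<le> R"
proof -
  interpret prob_space "alg x"
    using algorithm_prob_space[OF assms] by simp
  have "AE w in alg x. w \<in> {-R..R}"
    using assms by (simp add: algorithm_def)
  then have "(LINT w|alg x. w) \<le> R" "(LINT w|alg x. w) \<ge> -R"
    using algorithm_integrable[OF assms]
    by (auto intro!: integral_le_const integral_ge_const)
  then show ?thesis by linarith
qed

text \<open>The affine gap commutes with the inner expectation. The observed law is written as an
  image of \<open>M\<close> so that two such laws can later be compared on one probability
  space.\<close>

lemma expected_gap_linear:
  assumes alg: "algorithm N {-R..R} alg" and "R \<ge> 0"
    and "prob_space M" and f: "f \<in> M \<rightarrow>\<^sub>M sample_space N"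
  shows "expected_gap (\<lambda>t. \<zeta> * t) {-R..R} P (distr M (sample_space N) f) alg =
    (LINT x|M. \<zeta> * (LINT x|P. x) * (LINT w|alg (f x). w) + \<bar>\<zeta> * (LINT x|P. x)\<bar> * R)"
proof -
  define k where "k = \<zeta> * (LINT x|P. x)"
  have inner: "(LINT w|alg x. k * w + \<bar>k\<bar> * R) = k * (LINT w|alg x. w) + \<bar>k\<bar> * R"
    if "x \<in> space (sample_space N)" for x
  proof -
    interpret prob_space "alg x"
      using algorithm_prob_space[OF alg that] by simp
    show ?thesis
      using algorithm_integrable[OF alg that] by (simp add: prob_space)
  qed
  have "expected_gap (\<lambda>t. \<zeta> * t) {-R..R} P (distr M (sample_space N) f) alg =
      (LINT x|distr M (sample_space N) f. k * (LINT w|alg x. w) + \<bar>k\<bar> * R)"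
    unfolding expected_gap_def optimality_gap_linear[OF \<open>R \<ge> 0\<close>] k_def[symmetric]
    by (rule Bochner_Integration.integral_cong) (auto simp: inner)
  also have "\<dots> = (LINT x|M. k * (LINT w|alg (f x). w) + \<bar>k\<bar> * R)"
    by (intro integral_distr[OF f] borel_measurable_add borel_measurable_times
        borel_measurable_const algorithm_mean_measurable[OF alg])
  finally show ?thesis by (simp add: k_def)
qed

text \<open>Here \<open>M\<close> couples the two observed samples \<open>f x\<close> and
  \<open>g x\<close>. With \<open>h\<close> the mean output and \<open>k = \<zeta> * a\<close>, the
  two gaps sum to \<open>k * (h (f x) - h (g x) + 2 * R)\<close>. This is nonnegative everywhere
  because \<open>\<bar>h\<bar> \<le> R\<close>, and equals \<open>2 * k * R\<close> on
  \<open>E\<close>, where the samples agree.\<close>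

lemma two_point_bound:
  assumes alg: "algorithm N {-R..R} alg" and "R \<ge> 0" and "prob_space M"
    and f: "f \<in> M \<rightarrow>\<^sub>M sample_space N" and g: "g \<in> M \<rightarrow>\<^sub>M sample_space N"
    and E: "E \<in> sets M" and eq: "\<And>x. x \<in> E \<Longrightarrow> f x = g x"
    and mean: "(LINT x|P. x) = a" "(LINT x|P'. x) = - a" and "\<zeta> * a \<ge> 0"
  shows "expected_gap (\<lambda>t. \<zeta> * t) {-R..R} P (distr M (sample_space N) f) alg +
      expected_gap (\<lambda>t. \<zeta> * t) {-R..R} P' (distr M (sample_space N) g) alg
    \<ge> 2 * (\<zeta> * a) * R * measure M E"
proof -
  interpret prob_space M by fact
  define k where "k = \<zeta> * a"
  have "k \<ge> 0" using \<open>\<zeta> * a \<ge> 0\<close> by (simp add: k_def)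
  define h where "h x = (LINT w|alg x. w)" for x
  have h_meas: "h \<in> borel_measurable (sample_space N)"
    unfolding h_def by (rule algorithm_mean_measurable[OF alg])
  have h_bound: "\<bar>h x\<bar> \<le> R" if "x \<in> space (sample_space N)" for x
    using algorithm_mean_bound[OF alg that] by (simp add: h_def)
  have int: "integrable M (\<lambda>x. h (F x))" if F: "F \<in> M \<rightarrow>\<^sub>M sample_space N" for F
    using measurable_compose[OF F h_meas] h_bound measurable_space[OF F]
    by (intro integrable_const_bound[where B = R]) auto
  note int_f = int[OF f] and int_g = int[OF g]
  have "2 * k * R * measure M E = (LINT x|M. 2 * k * R * indicator E x)"
    using E by simp
  also have "\<dots> \<le> (LINT x|M. (k * h (f x) + k * R) + (- k * h (g x) + k * R))"
  proof (rule integral_mono)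
    fix x assume x: "x \<in> space M"
    have "\<bar>h (f x)\<bar> \<le> R" "\<bar>h (g x)\<bar> \<le> R"
      using x f g by (auto intro!: h_bound dest: measurable_space)
    then have "0 \<le> k * (h (f x) - h (g x) + 2 * R)"
      using \<open>k \<ge> 0\<close> by (intro mult_nonneg_nonneg) auto
    then show "2 * k * R * indicator E x \<le> (k * h (f x) + k * R) + (- k * h (g x) + k * R)"
      using eq[of x] by (cases "x \<in> E") (auto simp: algebra_simps)
  qed (use E int_f int_g in \<open>auto simp: emeasure_eq_measure\<close>)
  also have "\<dots> = (LINT x|M. k * h (f x) + k * R) + (LINT x|M. - k * h (g x) + k * R)"
    using int_f int_g by (intro Bochner_Integration.integral_add) auto
  finally show ?thesis
    unfolding expected_gap_linear[OF alg \<open>R \<ge> 0\<close> \<open>prob_space M\<close> f]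
      expected_gap_linear[OF alg \<open>R \<ge> 0\<close> \<open>prob_space M\<close> g] mean h_def[symmetric]
    using \<open>k \<ge> 0\<close> by (simp add: k_def)
qed

subsection \<open>The spike distributions\<close>

text \<open>As an image of a Bernoulli law, its integrals reduce to two-term sums. The two hard
  distributions are the cases \<open>p = \<epsilon>\<close> with \<open>a\<close> equal to plus or
  minus \<open>\<sigma> / sqrt \<epsilon>\<close>.\<close>

definition spike :: "real \<Rightarrow> real \<Rightarrow> real measure" where
  "spike p a = distr (measure_pmf (bernoulli_pmf p)) borel (\<lambda>b. if b then a else 0)"

lemma sets_spike [simp, measurable_cong]: "sets (spike p a) = sets borel"
  by (simp add: spike_def)

lemma space_spike [simp]: "space (spike p a) = UNIV"
  by (simp add: spike_def)

lemma real_distribution_spike: "real_distribution (spike p a)"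
  unfolding spike_def
  by (rule prob_space.real_distribution_distr[OF prob_space_measure_pmf]) simp

lemma integral_spike:
  fixes f :: "real \<Rightarrow> real"
  assumes "0 \<le> p" "p \<le> 1" and [measurable]: "f \<in> borel_measurable borel"
  shows "(LINT x|spike p a. f x) = p * f a + (1 - p) * f 0"
  using assms(1,2) by (simp add: spike_def integral_distr)

lemma measure_spike:
  assumes "0 \<le> p" "p \<le> 1" "A \<in> sets borel"
  shows "measure (spike p a) A = p * indicator A a + (1 - p) * indicator A 0"
  using integral_spike[OF assms(1,2), of "indicator A" a] assms(3) by simp

lemma variance_spike:
  assumes "0 \<le> p" "p \<le> 1"
  shows "prob_space.variance (spike p a) (\<lambda>x. x) = p * (1 - p) * a\<^sup>2"
  using assms by (simp add: integral_spike power2_eq_square algebra_simps)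

lemma distr_uminus_spike: "distr (spike p a) borel uminus = spike p (- a)"
  unfolding spike_def by (subst distr_distr) (auto simp: comp_def intro!: distr_cong)

text \<open>On a set \<open>A\<close> the two measures differ by \<open>p\<close> times the
  difference of the indicators of \<open>A\<close> at \<open>a\<close> and at 0.\<close>

lemma tv_spike_return:
  assumes "0 \<le> p" "p \<le> 1"
  shows "tv (spike p a) (return borel 0) \<le> p"
  unfolding tv_def
proof (rule cSUP_least)
  fix A :: "real set" assume A: "A \<in> sets borel"
  then show "\<bar>measure (spike p a) A - measure (return borel 0) A\<bar> \<le> p"
    using assms by (auto simp: measure_spike measure_return indicator_def)
qed (use sets.empty_sets in blast)

subsection \<open>The number of nonzero points in a clean sample\<close>

lemma one_minus_power_ge_exp:
  fixes \<epsilon> :: real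
  assumes "0 < \<epsilon>" "\<epsilon> < 1/2"
  shows "exp (- 2 * \<epsilon> * real N) \<le> (1 - \<epsilon>) ^ N"
proof -
  \<comment> \<open>The product is \<open>1 + \<epsilon> * (1 - 2 * \<epsilon>)\<close>; this is
    where \<open>\<epsilon> < 1/2\<close> enters.\<close>
  have "1 \<le> (1 + 2 * \<epsilon>) * (1 - \<epsilon>)"
    using mult_nonneg_nonneg[of \<epsilon> "1 - 2 * \<epsilon>"] assms by (simp add: algebra_simps)
  also have "\<dots> \<le> exp (2 * \<epsilon>) * (1 - \<epsilon>)"
    using assms by (intro mult_right_mono exp_ge_add_one_self) auto
  finally have "exp (- 2 * \<epsilon>) \<le> 1 - \<epsilon>"
    by (simp add: exp_minus field_simps)
  then have "exp (- 2 * \<epsilon>) ^ N \<le> (1 - \<epsilon>) ^ N"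
    by (intro power_mono) auto
  then show ?thesis
    by (simp flip: exp_of_nat_mult add: mult_ac)
qed

text \<open>The prefix length is a parameter so that \<open>n = N\<close> gives the total count,
  while \<open>n = i\<close> ranks position \<open>i\<close> for the adversary.\<close>

definition nonzeros :: "nat \<Rightarrow> (nat \<Rightarrow> real) \<Rightarrow> nat" where
  "nonzeros n x = card {j. j < n \<and> x j \<noteq> 0}"

lemma sets_iid [measurable_cong]:
  "sets P = sets borel \<Longrightarrow> sets (iid N P) = sets (sample_space N)"
  unfolding iid_def sample_space_def by (rule sets_PiM_cong) auto

lemma prob_space_iid: "prob_space P \<Longrightarrow> prob_space (iid N P)"
  unfolding iid_def by (rule prob_space_PiM)

lemma measurable_nonzeros:
  assumes "n \<le> N"
  shows "nonzeros n \<in> sample_space N \<rightarrow>\<^sub>M count_space UNIV"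
proof -
  have "{x \<in> space (sample_space N). i \<in> {j. j < n \<and> x j \<noteq> 0}} \<in> sets (sample_space N)" for i
  proof (cases "i < n")
    case True
    then have "i \<in> {..<N}" using assms by auto
    then show ?thesis using True by (simp add: sample_space_def)
  qed simp
  then show ?thesis
    unfolding nonzeros_def by (rule measurable_card)
qed

lemmas measurable_nonzeros_self [measurable] = measurable_nonzeros[OF order_refl]

lemma measure_nonzeros_eq_0:
  assumes "prob_space P" "sets P = sets borel" "measure P {0} = p"
  shows "measure (iid N P) {x \<in> space (iid N P). nonzeros N x = 0} = p ^ N"
proof -
  interpret S: prob_space P by fact
  interpret prod: finite_product_prob_space "\<lambda>_. P" "{..<N}"
    by unfold_locales auto
  have sp: "space P = UNIV"
    using sets_eq_imp_space_eq[OF assms(2)] by simp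
  have "{x \<in> space (iid N P). nonzeros N x = 0} = (\<Pi>\<^sub>E i\<in>{..<N}. {0})"
    by (auto simp: iid_def space_PiM nonzeros_def PiE_iff sp extensional_def intro!: ext)
  then show ?thesis
    using prod.finite_measure_PiM_emb[of "\<lambda>_. {0}"] assms by (simp add: iid_def)
qed

text \<open>Linearity of expectation: the count is a sum of indicators, one per coordinate, and each
  coordinate has marginal \<open>P\<close>.\<close>

lemma expectation_nonzeros:
  assumes "prob_space P" and sP: "sets P = sets borel" and P0: "measure P {0} = 1 - p"
  shows "integrable (iid N P) (\<lambda>x. real (nonzeros N x))"
    and "(LINT x|iid N P. real (nonzeros N x)) = p * real N"
proof -
  interpret P: prob_space P by fact
  interpret I: prob_space "iid N P"
    using assms(1) by (rule prob_space_iid)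
  have [measurable_cong]: "sets (iid N P) = sets (sample_space N)"
    using sP by (rule sets_iid)
  show "integrable (iid N P) (\<lambda>x. real (nonzeros N x))"
  proof (rule I.integrable_const_bound[where B = "real N"])
    have "nonzeros N x \<le> N" for x
      using card_mono[of "{..<N}" "{j. j < N \<and> x j \<noteq> 0}"] by (auto simp: nonzeros_def)
    then show "AE x in iid N P. norm (real (nonzeros N x)) \<le> real N" by simp
  qed measurable
  have comp: "(\<lambda>x. x i) \<in> iid N P \<rightarrow>\<^sub>M P" if "i < N" for i
    unfolding iid_def using that by simp
  have ind: "(indicator (-{0}) :: real \<Rightarrow> real) \<in> borel_measurable P"
    using sP by simp
  have one: "(LINT x|iid N P. indicator (-{0}) (x i)) = p"
    and int_one: "integrable (iid N P) (\<lambda>x. indicator (-{0}) (x i) :: real)" if "i < N" for i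
  proof -
    have "(LINT x|iid N P. indicator (-{0}) (x i)) = (LINT y|distr (iid N P) P (\<lambda>x. x i). indicator (-{0}) y :: real)"
      by (rule integral_distr[symmetric, OF comp[OF that] ind])
    also have "distr (iid N P) P (\<lambda>x. x i) = P"
      unfolding iid_def using that assms(1) by (intro distr_PiM_component) auto
    also have "(LINT y|P. indicator (-{0}) y :: real) = measure P (space P - {0})"
      using sets_eq_imp_space_eq[OF sP] by (simp add: Compl_eq_Diff_UNIV)
    also have "\<dots> = p"
      using P.prob_compl[of "{0}"] P0 sP by simp
    finally show "(LINT x|iid N P. indicator (-{0}) (x i)) = p" .
    show "integrable (iid N P) (\<lambda>x. indicator (-{0}) (x i) :: real)"
      using measurable_compose[OF comp[OF that] ind]
      by (intro I.integrable_const_bound[where B = 1]) (auto simp: indicator_def)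
  qed
  have "real (nonzeros N x) = (\<Sum>i<N. indicator (-{0}) (x i))" for x
  proof -
    have "{j. j < N \<and> x j \<noteq> 0} = {j \<in> {..<N}. x j \<in> -{0}}" by auto
    then show ?thesis
      by (simp add: nonzeros_def indicator_def sum.If_cases Int_def)
  qed
  then show "(LINT x|iid N P. real (nonzeros N x)) = p * real N"
    using int_one one by (simp add: mult.commute)
qed

lemma measure_few_nonzeros_ge:
  assumes \<epsilon>: "0 < \<epsilon>" "\<epsilon> < 1/2"
    and P: "prob_space P" "sets P = sets borel" "measure P {0} = 1 - \<epsilon>"
  shows "1/8 \<le> measure (iid N P) {x \<in> space (iid N P). nonzeros N x \<le> 2 * nat \<lfloor>\<epsilon> * real N\<rfloor>}"
proof -
  interpret I: prob_space "iid N P"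
    using P(1) by (rule prob_space_iid)
  have [measurable_cong]: "sets (iid N P) = sets (sample_space N)"
    using P(2) by (rule sets_iid)
  define m where "m = nat \<lfloor>\<epsilon> * real N\<rfloor>"
  have m: "real m \<le> \<epsilon> * real N" "\<epsilon> * real N < real m + 1"
    using \<epsilon> by (auto simp: m_def)
  show ?thesis
  proof (cases "m = 0")
    case True
    \<comment> \<open>The square of 2.72 is below 8, which is the source of the constant
      1/8.\<close>
    have "(2::real) * 2 * 2 \<ge> exp 1 * exp 1"
      using mult_mono[of "exp 1 :: real" "272/100" "exp 1" "272/100"] e_less_272 by simp
    then have "1/8 \<le> exp (-2::real)"
      by (simp add: exp_minus field_simps flip: exp_add)
    also have "\<dots> \<le> exp (- 2 * \<epsilon> * real N)"
      using m(2) True by simp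
    also have "\<dots> \<le> (1 - \<epsilon>) ^ N"
      by (rule one_minus_power_ge_exp[OF \<epsilon>])
    finally show ?thesis
      using measure_nonzeros_eq_0[OF P, of N] True by (simp add: m_def[symmetric])
  next
    case False
    let ?A = "{x \<in> space (iid N P). nonzeros N x \<le> 2 * m}"
    have "space (iid N P) - ?A = {x \<in> space (iid N P). real (2 * m + 1) \<le> real (nonzeros N x)}"
      by auto
    then have "1 - measure (iid N P) ?A =
        measure (iid N P) {x \<in> space (iid N P). real (2 * m + 1) \<le> real (nonzeros N x)}"
      using I.prob_compl[of ?A] by simp
    also have "\<dots> \<le> (LINT x|iid N P. real (nonzeros N x)) / real (2 * m + 1)"
      using expectation_nonzeros(1)[OF P]
      by (intro integral_Markov_inequality_measure[where A = "{}"]) auto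
    also have "\<dots> = \<epsilon> * real N / real (2 * m + 1)"
      using expectation_nonzeros(2)[OF P] by simp
    \<comment> \<open>Since \<open>\<epsilon> * N < m + 1\<close>, the quotient is below
      \<open>(m + 1) / (2 * m + 1)\<close>, which for \<open>m \<ge> 1\<close> is largest at
      \<open>m = 1\<close>. The event thus keeps probability at least 1/3.\<close>
    also have "\<dots> \<le> 2/3"
      using m(2) False by (simp add: field_simps)
    finally show ?thesis by (simp add: m_def)
  qed
qed

subsection \<open>The sign-flipping adversary\<close>

text \<open>For \<open>x i \<noteq> 0\<close>, \<open>nonzeros i x\<close> is the rank of \<open>i\<close> among the nonzero positions, counted from 0.\<close>

definition flip :: "nat \<Rightarrow> nat \<Rightarrow> nat \<Rightarrow> (nat \<Rightarrow> real) \<Rightarrow> nat \<Rightarrow> real" where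
  "flip N a b x = (\<lambda>i\<in>{..<N}. if a \<le> nonzeros i x \<and> nonzeros i x < b then - x i else x i)"

text \<open>Position \<open>i\<close> itself is counted in the prefix of length \<open>j\<close> but
  not in that of length \<open>i\<close>. Hence distinct nonzero positions have distinct
  ranks.\<close>

lemma nonzeros_strict_mono:
  assumes "i < j" "x i \<noteq> 0"
  shows "nonzeros i x < nonzeros j x"
  unfolding nonzeros_def using assms by (intro psubset_card_mono) auto

lemma measurable_flip [measurable]: "flip N a b \<in> sample_space N \<rightarrow>\<^sub>M sample_space N"
proof -
  have "(\<lambda>x. if a \<le> nonzeros i x \<and> nonzeros i x < b then - x i else x i)
      \<in> borel_measurable (sample_space N)" if "i < N" for i
  proof -
    have [measurable]: "nonzeros i \<in> sample_space N \<rightarrow>\<^sub>M count_space UNIV"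
      using that by (intro measurable_nonzeros) simp
    have [measurable]: "(\<lambda>x. x i) \<in> borel_measurable (sample_space N)"
      using that by (simp add: sample_space_def)
    show ?thesis by measurable
  qed
  then show ?thesis
    unfolding flip_def sample_space_def by (intro measurable_restrict) (simp add: sample_space_def)
qed

text \<open>Negation fixes 0, so every changed position is nonzero, and the ranks of these positions
  are distinct elements of \<open>{a..<b}\<close>.\<close>

lemma card_flip_changes: "card {i \<in> {..<N}. flip N a b x i \<noteq> x i} \<le> b - a"
proof -
  let ?C = "{i \<in> {..<N}. flip N a b x i \<noteq> x i}"
  have nz: "x i \<noteq> 0" "nonzeros i x \<in> {a..<b}" if "i \<in> ?C" for i
    using that by (auto simp: flip_def split: if_splits)
  have "inj_on (\<lambda>i. nonzeros i x) ?C"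
  proof (rule linorder_inj_onI')
    show "nonzeros i x \<noteq> nonzeros j x" if "i \<in> ?C" "i < j" for i j
      using nonzeros_strict_mono[of i j x] that nz(1) by simp
  qed
  then have "card ?C \<le> card {a..<b}"
    using nz(2) by (intro card_inj_on_le[of "\<lambda>i. nonzeros i x"]) auto
  then show ?thesis by simp
qed

text \<open>Negation preserves ranks. On either side the nonzero points of rank below
  \<open>m\<close> end up negated relative to \<open>x\<close>, and those of rank in
  \<open>{m..<2 * m}\<close> end up as in \<open>x\<close>; by assumption there are no
  others.\<close>

lemma flip_uminus_eq:
  assumes "nonzeros N x \<le> 2 * m"
  shows "flip N m (2 * m) (compose {..<N} uminus x) = flip N 0 m x"
proof -
  have "nonzeros i (compose {..<N} uminus x) = nonzeros i x" if "i < N" for i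
    unfolding nonzeros_def using that
    by (intro arg_cong[where f = card]) (auto simp: compose_def)
  moreover have "nonzeros i x < 2 * m" if "i < N" "x i \<noteq> 0" for i
    using nonzeros_strict_mono[of i N x] that assms by simp
  ultimately show ?thesis
    by (fastforce simp: flip_def compose_def fun_eq_iff)
qed

text \<open>A deterministic adversary is a kernel of point masses, and binding with it is the same
  as taking the image measure.\<close>

lemma replacement_corruption_flip:
  assumes P: "prob_space P" "sets P = sets borel" and "real (b - a) \<le> \<epsilon> * real N"
  shows "replacement_corruption \<epsilon> N P (distr (iid N P) (sample_space N) (flip N a b))"
  unfolding replacement_corruption_def
proof (intro bexI conjI ballI)
  let ?T = "\<lambda>x. return (sample_space N) (flip N a b x)"
  show "?T \<in> sample_space N \<rightarrow>\<^sub>M prob_algebra (sample_space N)"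
    by (rule measurable_compose[OF measurable_flip measurable_return_prob_space])
  have m: "flip N a b \<in> iid N P \<rightarrow>\<^sub>M sample_space N"
    using sets_iid[OF P(2)] measurable_flip by (simp cong: measurable_cong_sets)
  show "distr (iid N P) (sample_space N) (flip N a b) = iid N P \<bind> ?T"
    using prob_space.not_empty[OF prob_space_iid[OF P(1)]] m
    by (simp add: bind_return_distr')
  fix x assume x: "x \<in> space (sample_space N)"
  \<comment> \<open>Reducing the almost-sure statement under a point mass to its value at that
    point, via \<open>AE_return\<close>, requires the corruption budget to be a measurable
    predicate.\<close>
  have "{y \<in> space (sample_space N). i \<in> {i \<in> {..<N}. y i \<noteq> x i}} \<in> sets (sample_space N)" for i
    by (cases "i < N") (simp_all add: sample_space_def)
  then have "(\<lambda>y. card {i \<in> {..<N}. y i \<noteq> x i}) \<in> sample_space N \<rightarrow>\<^sub>M count_space UNIV"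
    by (rule measurable_card)
  then have pred: "Measurable.pred (sample_space N)
      (\<lambda>y. real (card {i \<in> {..<N}. y i \<noteq> x i}) \<le> \<epsilon> * real N)"
    by (rule measurable_compose) simp
  have "real (card {i \<in> {..<N}. flip N a b x i \<noteq> x i}) \<le> \<epsilon> * real N"
    using card_flip_changes[of N a b x] assms(3) by linarith
  then show "AE y in ?T x. real (card {i \<in> {..<N}. y i \<noteq> x i}) \<le> \<epsilon> * real N"
    using AE_return[OF measurable_space[OF measurable_flip x] pred] by simp
qed

text \<open>This supplies the coupling: a clean sample of the mirrored distribution is the pointwise
  negation of a clean sample of \<open>P\<close>.\<close>

lemma iid_distr_uminus:
  assumes "prob_space P" "sets P = sets borel"
  shows "compose {..<N} uminus \<in> iid N P \<rightarrow>\<^sub>M sample_space N"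
    and "iid N (distr P borel uminus) = distr (iid N P) (sample_space N) (compose {..<N} uminus)"
proof -
  have u: "uminus \<in> P \<rightarrow>\<^sub>M borel"
    using assms(2) by (simp cong: measurable_cong_sets)
  have "(\<lambda>x. - x i) \<in> iid N P \<rightarrow>\<^sub>M borel" if "i < N" for i
    using that measurable_compose[of "\<lambda>x. x i" "iid N P" P, OF _ u]
    by (simp add: iid_def)
  then show "compose {..<N} uminus \<in> iid N P \<rightarrow>\<^sub>M sample_space N"
    unfolding compose_def sample_space_def by (intro measurable_restrict) auto
  \<comment> \<open>\<open>distr_PiM_finite_prob_space'\<close> wants probability spaces as targets, so \<open>return borel 0\<close> stands in
    for \<open>borel\<close>; only its sigma-algebra matters.\<close>
  have "(\<Pi>\<^sub>M i\<in>{..<N}. distr P borel uminus) = distr (\<Pi>\<^sub>M i\<in>{..<N}. P) (\<Pi>\<^sub>M i\<in>{..<N}. return borel 0) (compose {..<N} uminus)"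
  proof -
    have "distr (\<Pi>\<^sub>M i\<in>{..<N}. P) (\<Pi>\<^sub>M i\<in>{..<N}. return borel 0) (compose {..<N} uminus) =
        (\<Pi>\<^sub>M i\<in>{..<N}. distr P (return borel 0) uminus)"
      using u assms(1) by (intro distr_PiM_finite_prob_space') (auto intro: prob_space_return)
    moreover have "distr P (return borel 0) uminus = distr P borel uminus"
      by (rule distr_cong) auto
    ultimately show ?thesis by simp
  qed
  also have "\<dots> = distr (\<Pi>\<^sub>M i\<in>{..<N}. P) (\<Pi>\<^sub>M i\<in>{..<N}. borel) (compose {..<N} uminus)"
    by (rule distr_cong) (auto intro!: sets_PiM_cong)
  finally show "iid N (distr P borel uminus) = distr (iid N P) (sample_space N) (compose {..<N} uminus)"
    by (simp add: iid_def sample_space_def)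
qed

subsection \<open>Lower bounds under the two contamination models\<close>

lemma replacement_gap_sum:
  assumes \<epsilon>: "0 < \<epsilon>" "\<epsilon> < 1/2" and "a > 0" "\<zeta> > 0" "R > 0" and alg: "algorithm N {-R..R} alg"
  obtains Q Q' where "replacement_corruption \<epsilon> N (spike \<epsilon> a) Q"
    and "replacement_corruption \<epsilon> N (spike \<epsilon> (- a)) Q'"
    and "expected_gap (\<lambda>t. \<zeta> * t) {-R..R} (spike \<epsilon> a) Q alg +
      expected_gap (\<lambda>t. \<zeta> * t) {-R..R} (spike \<epsilon> (- a)) Q' alg \<ge> \<zeta> * (\<epsilon> * a) * R / 4"
proof -
  let ?P = "spike \<epsilon> a" and ?P' = "spike \<epsilon> (- a)"
  interpret P: real_distribution ?P by (rule real_distribution_spike)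
  interpret P': real_distribution ?P' by (rule real_distribution_spike)
  define m where "m = nat \<lfloor>\<epsilon> * real N\<rfloor>"
  have m: "real m \<le> \<epsilon> * real N" using \<epsilon> by (simp add: m_def)
  have sets_iid_P [measurable_cong]: "sets (iid N ?P) = sets (sample_space N)"
    by (rule sets_iid) simp
  define E where "E = {x \<in> space (iid N ?P). nonzeros N x \<le> 2 * m}"
  have E: "E \<in> sets (iid N ?P)" unfolding E_def by measurable
  have "1/8 \<le> measure (iid N ?P) E"
    unfolding E_def m_def using \<epsilon> \<open>a > 0\<close> P.prob_space_axioms
    by (intro measure_few_nonzeros_ge) (auto simp: measure_spike)
  define Q where "Q = distr (iid N ?P) (sample_space N) (flip N 0 m)"
  define Q' where "Q' = distr (iid N ?P') (sample_space N) (flip N m (2 * m))"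
  note neg = iid_distr_uminus[OF P.prob_space_axioms sets_spike, of N, unfolded distr_uminus_spike]
  \<comment> \<open>Both observed laws become images of the same space \<open>iid N ?P\<close>, as
    \<open>two_point_bound\<close> requires.\<close>
  have Q'_eq: "Q' = distr (iid N ?P) (sample_space N) (flip N m (2 * m) \<circ> compose {..<N} uminus)"
    unfolding Q'_def neg(2) by (rule distr_distr[OF measurable_flip neg(1)])
  have "replacement_corruption \<epsilon> N ?P Q"
    unfolding Q_def using m P.prob_space_axioms by (intro replacement_corruption_flip) auto
  moreover have "replacement_corruption \<epsilon> N ?P' Q'"
    unfolding Q'_def using m P'.prob_space_axioms by (intro replacement_corruption_flip) auto
  moreover have "2 * (\<zeta> * (\<epsilon> * a)) * R * measure (iid N ?P) E
    \<le> expected_gap (\<lambda>t. \<zeta> * t) {-R..R} ?P Q alg + expected_gap (\<lambda>t. \<zeta> * t) {-R..R} ?P' Q' alg"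
    unfolding Q_def Q'_eq
  proof (rule two_point_bound[OF alg _ prob_space_iid[OF P.prob_space_axioms] _ _ E])
    show "flip N m (2 * m) \<circ> compose {..<N} uminus \<in> iid N ?P \<rightarrow>\<^sub>M sample_space N"
      by (rule measurable_comp[OF neg(1) measurable_flip])
    show "flip N 0 m x = (flip N m (2 * m) \<circ> compose {..<N} uminus) x" if "x \<in> E" for x
      using that flip_uminus_eq[of N x m] by (simp add: E_def)
  qed (use \<epsilon> \<open>a > 0\<close> \<open>\<zeta> > 0\<close> \<open>R > 0\<close> in \<open>auto simp: integral_spike\<close>)
  moreover have "\<zeta> * (\<epsilon> * a) * R / 4 = 2 * (\<zeta> * (\<epsilon> * a)) * R * (1/8)"
    by simp
  moreover have "2 * (\<zeta> * (\<epsilon> * a)) * R * (1/8) \<le> 2 * (\<zeta> * (\<epsilon> * a)) * R * measure (iid N ?P) E"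
    using \<open>1/8 \<le> measure (iid N ?P) E\<close> \<epsilon> \<open>a > 0\<close> \<open>\<zeta> > 0\<close> \<open>R > 0\<close> by (intro mult_left_mono) auto
  ultimately show ?thesis
    by (intro that[of Q Q']) linarith+
qed

text \<open>Both spikes are within \<epsilon> of the point mass at 0, so one law \<open>Q\<close>
  serves for both. The coupling is the identity, with \<open>E\<close> the whole space. The bound is
  stated with the weaker factor 1/4 to match the replacement model.\<close>

lemma tv_gap_sum:
  assumes \<epsilon>: "0 < \<epsilon>" "\<epsilon> < 1/2" and "a > 0" "\<zeta> > 0" "R > 0" and alg: "algorithm N {-R..R} alg"
  obtains Q where "tv_corruption \<epsilon> N (spike \<epsilon> a) Q" and "tv_corruption \<epsilon> N (spike \<epsilon> (- a)) Q"
    and "expected_gap (\<lambda>t. \<zeta> * t) {-R..R} (spike \<epsilon> a) Q alg +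
      expected_gap (\<lambda>t. \<zeta> * t) {-R..R} (spike \<epsilon> (- a)) Q alg \<ge> \<zeta> * (\<epsilon> * a) * R / 4"
proof -
  define Q where "Q = iid N (return borel 0)"
  have "prob_space (return borel (0::real))"
    by (rule prob_space_return) simp
  then have "real_distribution (return borel (0::real))"
    by (simp add: real_distribution_def real_distribution_axioms_def)
  then have tv: "tv_corruption \<epsilon> N (spike \<epsilon> b) Q" for b
    unfolding tv_corruption_def Q_def using tv_spike_return[of \<epsilon> b] \<epsilon> by auto
  interpret Q: prob_space Q
    unfolding Q_def by (rule prob_space_iid) fact
  have sQ: "sets Q = sets (sample_space N)"
    unfolding Q_def by (rule sets_iid) simp
  then have Q_eq: "distr Q (sample_space N) id = Q"
    by (simp add: distr_id2 id_def)
  have "2 * (\<zeta> * (\<epsilon> * a)) * R * measure Q (space Q)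
      \<le> expected_gap (\<lambda>t. \<zeta> * t) {-R..R} (spike \<epsilon> a) (distr Q (sample_space N) id) alg +
        expected_gap (\<lambda>t. \<zeta> * t) {-R..R} (spike \<epsilon> (- a)) (distr Q (sample_space N) id) alg"
    by (rule two_point_bound[OF alg _ Q.prob_space_axioms _ _ sets.top])
      (use sQ \<epsilon> \<open>a > 0\<close> \<open>\<zeta> > 0\<close> \<open>R > 0\<close> in \<open>auto simp: integral_spike id_def cong: measurable_cong_sets\<close>)
  moreover have "0 < \<zeta> * (\<epsilon> * a) * R"
    using \<epsilon> \<open>a > 0\<close> \<open>\<zeta> > 0\<close> \<open>R > 0\<close> by simp
  ultimately show ?thesis
    using tv by (intro that[of Q]) (auto simp: Q_eq Q.prob_space)
qed

theorem lemma4p8: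
  "\<exists>c::real. c > 0 \<and>
     (\<forall>\<epsilon> D \<zeta> \<sigma> :: real.
        0 < \<epsilon> \<longrightarrow> \<epsilon> < 1/2 \<longrightarrow> D > 0 \<longrightarrow> \<zeta> > 0 \<longrightarrow> \<sigma> > 0 \<longrightarrow>
        (\<exists>\<phi> P\<^sub>A P\<^sub>B.
           convex_on UNIV \<phi> \<and> \<zeta>-lipschitz_on UNIV \<phi> \<and>
           real_distribution P\<^sub>A \<and>
           measure P\<^sub>A {0} = 1 - \<epsilon> \<and> measure P\<^sub>A {\<sigma> / sqrt \<epsilon>} = \<epsilon> \<and>
           prob_space.variance P\<^sub>A (\<lambda>x. x) \<le> \<sigma>\<^sup>2 \<and>
           real_distribution P\<^sub>B \<and>
           measure P\<^sub>B {0} = 1 - \<epsilon> \<and> measure P\<^sub>B {- \<sigma> / sqrt \<epsilon>} = \<epsilon> \<and>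
           prob_space.variance P\<^sub>B (\<lambda>x. x) \<le> \<sigma>\<^sup>2 \<and>
           (\<forall>N alg. algorithm N {-D/2..D/2} alg \<longrightarrow>
              (\<forall>corruption \<in> {replacement_corruption, tv_corruption}.
                 \<exists>P \<in> {P\<^sub>A, P\<^sub>B}. \<exists>Q. corruption \<epsilon> N P Q \<and>
                   expected_gap \<phi> {-D/2..D/2} P Q alg \<ge> c * \<zeta> * D * \<sigma> * sqrt \<epsilon>))))"
\<comment> \<open>With \<open>R = D/2\<close> the gaps sum to at least 1/8 of
  \<open>\<zeta> * D * \<sigma> * sqrt \<epsilon>\<close>, and the larger one is at least half of
  the sum.\<close>
proof (intro exI[of _ "1/16"] conjI allI impI)
  fix \<epsilon> D \<zeta> \<sigma> :: real
  assume \<epsilon>: "0 < \<epsilon>" "\<epsilon> < 1/2" and pos: "D > 0" "\<zeta> > 0" "\<sigma> > 0"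
  \<comment> \<open>This scale gives second moment
    \<open>\<epsilon> * a\<^sup>2 = \<sigma>\<^sup>2\<close>, hence variance
    \<open>(1 - \<epsilon>) * \<sigma>\<^sup>2\<close>, and mean
    \<open>\<sigma> * sqrt \<epsilon>\<close>.\<close>
  define a where "a = \<sigma> / sqrt \<epsilon>"
  have "a > 0" using \<epsilon> pos by (simp add: a_def)
  have \<epsilon>a: "\<epsilon> * a = \<sigma> * sqrt \<epsilon>"
    using \<epsilon> by (simp add: a_def field_simps)
  have a2: "\<epsilon> * a\<^sup>2 = \<sigma>\<^sup>2"
    using \<epsilon> by (simp add: a_def power_divide)
  have var: "prob_space.variance (spike \<epsilon> b) (\<lambda>x. x) \<le> \<sigma>\<^sup>2" if "b\<^sup>2 = a\<^sup>2" for b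
  proof -
    have "prob_space.variance (spike \<epsilon> b) (\<lambda>x. x) = (1 - \<epsilon>) * \<sigma>\<^sup>2"
      using \<epsilon> that variance_spike[of \<epsilon> b] a2 by (simp add: mult_ac)
    also have "\<dots> \<le> \<sigma>\<^sup>2"
      using \<epsilon> by (intro mult_left_le_one_le) auto
    finally show ?thesis .
  qed
  show "\<exists>\<phi> P\<^sub>A P\<^sub>B.
           convex_on UNIV \<phi> \<and> \<zeta>-lipschitz_on UNIV \<phi> \<and>
           real_distribution P\<^sub>A \<and>
           measure P\<^sub>A {0} = 1 - \<epsilon> \<and> measure P\<^sub>A {\<sigma> / sqrt \<epsilon>} = \<epsilon> \<and>
           prob_space.variance P\<^sub>A (\<lambda>x. x) \<le> \<sigma>\<^sup>2 \<and>
           real_distribution P\<^sub>B \<and>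
           measure P\<^sub>B {0} = 1 - \<epsilon> \<and> measure P\<^sub>B {- \<sigma> / sqrt \<epsilon>} = \<epsilon> \<and>
           prob_space.variance P\<^sub>B (\<lambda>x. x) \<le> \<sigma>\<^sup>2 \<and>
           (\<forall>N alg. algorithm N {-D/2..D/2} alg \<longrightarrow>
              (\<forall>corruption \<in> {replacement_corruption, tv_corruption}.
                 \<exists>P \<in> {P\<^sub>A, P\<^sub>B}. \<exists>Q. corruption \<epsilon> N P Q \<and>
                   expected_gap \<phi> {-D/2..D/2} P Q alg \<ge> 1/16 * \<zeta> * D * \<sigma> * sqrt \<epsilon>))"
  proof (intro exI conjI allI impI)
    show "convex_on UNIV (\<lambda>t. \<zeta> * t)"
      by (rule convex_onI) (auto simp: algebra_simps)
    show "\<zeta>-lipschitz_on UNIV (\<lambda>t. \<zeta> * t)"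
      using pos by (intro lipschitz_onI) (auto simp: dist_real_def abs_mult simp flip: right_diff_distrib)
    show "real_distribution (spike \<epsilon> a)" "real_distribution (spike \<epsilon> (- a))"
      by (rule real_distribution_spike)+
    show "measure (spike \<epsilon> a) {0} = 1 - \<epsilon>" "measure (spike \<epsilon> a) {\<sigma> / sqrt \<epsilon>} = \<epsilon>"
      "measure (spike \<epsilon> (- a)) {0} = 1 - \<epsilon>" "measure (spike \<epsilon> (- a)) {- \<sigma> / sqrt \<epsilon>} = \<epsilon>"
      using \<epsilon> pos by (auto simp: measure_spike a_def)
    show "prob_space.variance (spike \<epsilon> a) (\<lambda>x. x) \<le> \<sigma>\<^sup>2"
      "prob_space.variance (spike \<epsilon> (- a)) (\<lambda>x. x) \<le> \<sigma>\<^sup>2"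
      by (rule var, simp)+
    fix N alg assume "algorithm N {-D/2..D/2} alg"
    \<comment> \<open>The term \<open>-D/2\<close> parses as \<open>(-D)/2\<close>, whereas the
      lemmas expect \<open>-R\<close> with \<open>R = D/2\<close>.\<close>
    then have alg: "algorithm N {-(D/2)..D/2} alg" by simp
    have "D/2 > 0" using pos by simp
    have max: "\<exists>P \<in> {spike \<epsilon> a, spike \<epsilon> (- a)}. \<exists>Q. corruption \<epsilon> N P Q \<and>
        expected_gap (\<lambda>t. \<zeta> * t) {-D/2..D/2} P Q alg \<ge> 1/16 * \<zeta> * D * \<sigma> * sqrt \<epsilon>"
      if "corruption \<epsilon> N (spike \<epsilon> a) Q" "corruption \<epsilon> N (spike \<epsilon> (- a)) Q'"
        and "\<zeta> * (\<epsilon> * a) * (D/2) / 4 \<le>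
          expected_gap (\<lambda>t. \<zeta> * t) {-(D/2)..D/2} (spike \<epsilon> a) Q alg +
          expected_gap (\<lambda>t. \<zeta> * t) {-(D/2)..D/2} (spike \<epsilon> (- a)) Q' alg"
      for Q Q' and corruption :: "real \<Rightarrow> nat \<Rightarrow> real measure \<Rightarrow> (nat \<Rightarrow> real) measure \<Rightarrow> bool"
    proof -
      have "\<zeta> * (\<epsilon> * a) * (D/2) / 4 = 2 * (1/16 * \<zeta> * D * \<sigma> * sqrt \<epsilon>)"
        by (simp add: \<epsilon>a)
      then have "expected_gap (\<lambda>t. \<zeta> * t) {-D/2..D/2} (spike \<epsilon> a) Q alg \<ge> 1/16 * \<zeta> * D * \<sigma> * sqrt \<epsilon> \<or>
          expected_gap (\<lambda>t. \<zeta> * t) {-D/2..D/2} (spike \<epsilon> (- a)) Q' alg \<ge> 1/16 * \<zeta> * D * \<sigma> * sqrt \<epsilon>"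
        using that(3) by (simp only: minus_divide_left) linarith
      then show ?thesis using that(1,2) by blast
    qed
    show "\<forall>corruption \<in> {replacement_corruption, tv_corruption}.
        \<exists>P \<in> {spike \<epsilon> a, spike \<epsilon> (- a)}. \<exists>Q. corruption \<epsilon> N P Q \<and>
          expected_gap (\<lambda>t. \<zeta> * t) {-D/2..D/2} P Q alg \<ge> 1/16 * \<zeta> * D * \<sigma> * sqrt \<epsilon>"
    proof
      fix corruption assume "corruption \<in> {replacement_corruption, tv_corruption}"
      then consider "corruption = replacement_corruption" | "corruption = tv_corruption" by blast
      then show "\<exists>P \<in> {spike \<epsilon> a, spike \<epsilon> (- a)}. \<exists>Q. corruption \<epsilon> N P Q \<and>
          expected_gap (\<lambda>t. \<zeta> * t) {-D/2..D/2} P Q alg \<ge> 1/16 * \<zeta> * D * \<sigma> * sqrt \<epsilon>"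
      proof cases
        case 1
        show ?thesis unfolding 1
          by (rule replacement_gap_sum[OF \<epsilon> \<open>a > 0\<close> \<open>\<zeta> > 0\<close> \<open>D/2 > 0\<close> alg], rule max)
      next
        case 2
        show ?thesis unfolding 2
          by (rule tv_gap_sum[OF \<epsilon> \<open>a > 0\<close> \<open>\<zeta> > 0\<close> \<open>D/2 > 0\<close> alg], rule max)
      qed
    qed
  qed
qed simp

end
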